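(* Let $N,T\ge1$, $\mathcal{N}=\{1,\dots,N\}$, $\mathcal{T}=\{1,\dots,T\}$, $\mu>0$. Let $\mathbf{C}\in\mathbb{R}^{N\times N}$ and $\mathbf{y}_1,\dots,\mathbf{y}_T\in\mathbb{R}^N$ be the matrix and vectors specified in the context. For each $n\in\mathcal{N}$ let $\mathcal{Z}_n\subseteq\mathbb{R}^{M_n}$, let $K_n:\mathcal{Z}_n\times\mathcal{Z}_n\to\mathbb{R}$ be a symmetric positive definite kernel with reproducing kernel Hilbert space $\mathcal{H}_{\mathcal{K}_n}$ and norm $\|\cdot\|_{\mathcal{K}_n}$, let $\mathbf{z}_{n,1},\dots,\mathbf{z}_{n,T}\in\mathcal{Z}_n$, and let $\bar q_{n,t}^g\ge 0$ for $t\in\mathcal{T}$. Consider the functional minimization problem $$\text{(F)}\qquad \min\ \frac1T\sum_{t=1}^T\big\|\mathbf{C}\,\mathbf{q}^g_t+\mathbf{y}_t\big\|_2^2+\mu\sum_{n=1}^N\|f_n\|_{\mathcal{K}_n}^2$$ over $f_n\in\mathcal{H}_{\mathcal{K}_n}$ ($n\in\mathcal{N}$) and $\mathbf{b}=(b_1,\dots,b_N)^\top\in\mathbb{R}^N$, where $q_n^g(\mathbf{z}_n):=f_n(\mathbf{z}_n)+b_n$ and $\mathbf{q}_t^g:=[q_1^g(\mathbf{z}_{1,t})\ \cdots\ q_N^g(\mathbf{z}_{N,t})]^\top$, subject to $|q_n^g(\mathbf{z}_{n,t})|\le\bar q_{n,t}^g$ for all $n\in\mathcal{N}$, $t\in\mathcal{T}$.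 Let $\mathbf{K}_n\in\mathbb{R}^{T\times T}$ be the kernel matrix with $(t,t')$ entry $K_n(\mathbf{z}_{n,t},\mathbf{z}_{n,t'})$, let $\mathbf{Y}:=[\mathbf{y}_1\ \cdots\ \mathbf{y}_T]\in\mathbb{R}^{N\times T}$, let $\bar{\mathbf{q}}_n^g:=[\bar q_{n,1}^g\ \cdots\ \bar q_{n,T}^g]^\top$, and let $\mathbf{1}\in\mathbb{R}^T$ be the all-ones vector. Consider the vector problem $$\text{(P)}\qquad \begin{aligned}\min\ &\ \frac1T\|\mathbf{C}\mathbf{Q}+\mathbf{Y}\|_F^2+\mu\sum_{n=1}^N\mathbf{a}_n^\top\mathbf{K}_n\mathbf{a}_n\\ \text{over}\ &\ \mathbf{Q}\in\mathbb{R}^{N\times T},\ \mathbf{a}_1,\dots,\mathbf{a}_N\in\mathbb{R}^T,\ \mathbf{b}\in\mathbb{R}^N\\ \text{subject to}\ &\ \mathbf{Q}^\top=[\mathbf{K}_1\mathbf{a}_1+b_1\mathbf{1}\ \cdots\ \mathbf{K}_N\mathbf{a}_N+b_N\mathbf{1}],\\ &\ -\bar{\mathbf{q}}_n^g\le\mathbf{K}_n\mathbf{a}_n+b_n\mathbf{1}\le\bar{\mathbf{q}}_n^g\ \text{ (entrywise) for all } n\in\mathcal{N}.\end{aligned}$$ Then (F) and (P) are equivalent, in the following sense: they have the same optimal value; if $(\mathbf{Q},\{\mathbf{a}_n\},\mathbf{b})$ is a minimizer of (P), with $\mathbf{a}_n=[a_{n,1}\ \cdots\ a_{n,T}]^\top$,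 then the functions $f_n(\mathbf{z}_n)=\sum_{t=1}^T K_n(\mathbf{z}_n,\mathbf{z}_{n,t})\,a_{n,t}$ together with $\mathbf{b}$ form a minimizer of (F); and every minimizer of (F) is obtained in this way from some minimizer of (P).
   Context: A symmetric positive definite kernel on $\mathcal{Z}_n$ is meant in the usual kernel-learning sense: $K_n(\mathbf{z},\mathbf{z}')=K_n(\mathbf{z}',\mathbf{z})$ and $\sum_{i,j}c_ic_jK_n(\mathbf{z}_i,\mathbf{z}_j)\ge0$ for all finite families of points $\mathbf{z}_i\in\mathcal{Z}_n$ and reals $c_i$ (so kernel matrices are positive semidefinite). Its reproducing kernel Hilbert space $\mathcal{H}_{\mathcal{K}_n}$ is the usual one, consisting of functions $\mathcal{Z}_n\to\mathbb{R}$; for $f(\mathbf{z})=\sum_t K_n(\mathbf{z},\mathbf{z}_t)a_t$ the norm is $\|f\|_{\mathcal{K}_n}^2=\sum_{t}\sum_{t'}K_n(\mathbf{z}_t,\mathbf{z}_{t'})a_ta_{t'}$. $\|\cdot\|_F$ is the Frobenius norm. Data: $\mathbf{R},\mathbf{X}\in\mathbb{R}^{N\times N}$ are symmetric positive definite matrices (determined by the electric grid) and $\lambda\in[0,1]$. Set $\mathbf{C}:=[(1-\lambda)\mathbf{R}+\lambda\mathbf{X}^2]^{1/2}$, the unique symmetric positive definite square root. For each scenario $t\in\mathcal{T}$ there are given vectors $\mathbf{p}^g_t,\mathbf{p}^c_t,\mathbf{q}^c_t\in\mathbb{R}^N$ (solar generation, active load, reactive load), and $\mathbf{y}_t:=\mathbf{C}^{-1}[-(1-\lambda)\mathbf{R}\mathbf{q}^c_t+\lambda\mathbf{X}\mathbf{R}(\mathbf{p}^g_t-\mathbf{p}^c_t)-\lambda\mathbf{X}^2\mathbf{q}^c_t]$.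 The limits are $\bar q_{n,t}^g=\sqrt{(\bar s_n^g)^2-(p_{n,t}^g)^2}$, where $\bar s_n^g$ is the apparent power limit of inverter $n$ and $p^g_{n,t}$, the $n$-th entry of $\mathbf{p}^g_t$, satisfies $|p^g_{n,t}|\le\bar s_n^g$. The point $\mathbf{z}_{n,t}$ is the control input of inverter $n$ in scenario $t$, and $q_n^g(\mathbf{z}_n)=f_n(\mathbf{z}_n)+b_n$ is the reactive power injection prescribed by its control rule. *)

theory Defs
  imports "HOL-Analysis.Analysis"
begin

definition spd :: "real^'n^'n \<Rightarrow> bool" where
  "spd A \<longleftrightarrow> transpose A = A \<and> (\<forall>x. x \<noteq> 0 \<longrightarrow> 0 < x \<bullet> (A *v x))"

(* THE is well defined for spd A: an spd matrix has exactly one spd square root. *)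
definition spd_sqrt :: "real^'n^'n \<Rightarrow> real^'n^'n" where
  "spd_sqrt A = (THE B. spd B \<and> B ** B = A)"

definition frob_norm :: "real^'m^'n \<Rightarrow> real" where
  "frob_norm A = sqrt (\<Sum>i\<in>UNIV. \<Sum>j\<in>UNIV. (A $ i $ j)\<^sup>2)"

definition mat_of_columns :: "('t \<Rightarrow> real^'n) \<Rightarrow> real^'t^'n" where
  "mat_of_columns y = (\<chi> i t. y t $ i)"

(* Only the values of K on Z x Z matter; the points x i may repeat. *)
definition pd_kernel :: "'a set \<Rightarrow> ('a \<Rightarrow> 'a \<Rightarrow> real) \<Rightarrow> bool" where
  "pd_kernel Z K \<longleftrightarrow>
     (\<forall>x\<in>Z. \<forall>x'\<in>Z. K x x' = K x' x) \<and>
     (\<forall>(m::nat) x c. (\<forall>i<m. x i \<in> Z) \<longrightarrow> 0 \<le> (\<Sum>i<m. \<Sum>j<m. c i * c j * K (x i) (x j)))"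

(* Functions Z -> real are represented by total functions that vanish outside Z, so that
   equality of functions is equality on Z and pointwise vector space operations are available. *)
definition kernel_section :: "'a set \<Rightarrow> ('a \<Rightarrow> 'a \<Rightarrow> real) \<Rightarrow> 'a \<Rightarrow> 'a \<Rightarrow> real" where
  "kernel_section Z K x' = (\<lambda>x. if x \<in> Z then K x x' else 0)"

definition kernel_expansion ::
    "'a set \<Rightarrow> ('a \<Rightarrow> 'a \<Rightarrow> real) \<Rightarrow> ('t::finite \<Rightarrow> 'a) \<Rightarrow> real^'t \<Rightarrow> 'a \<Rightarrow> real" where
  "kernel_expansion Z K z a = (\<lambda>x. if x \<in> Z then \<Sum>t\<in>UNIV. K x (z t) * a $ t else 0)"

definition ip_norm :: "('f \<Rightarrow> 'f \<Rightarrow> real) \<Rightarrow> 'f \<Rightarrow> real" where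
  "ip_norm ip f = sqrt (ip f f)"

(* H with inner product ip is a Hilbert space of functions on Z having K as reproducing kernel;
   by the Moore-Aronszajn theorem Z and K determine H, and ip on H, uniquely. *)
locale rkhs =
  fixes Z :: "'a set"
    and K :: "'a \<Rightarrow> 'a \<Rightarrow> real"
    and H :: "('a \<Rightarrow> real) set"
    and ip :: "('a \<Rightarrow> real) \<Rightarrow> ('a \<Rightarrow> real) \<Rightarrow> real"
  assumes vanish_outside: "\<lbrakk>f \<in> H; x \<notin> Z\<rbrakk> \<Longrightarrow> f x = 0"
    and zero_mem: "(\<lambda>x. 0) \<in> H"
    and add_mem: "\<lbrakk>f \<in> H; g \<in> H\<rbrakk> \<Longrightarrow> (\<lambda>x. f x + g x) \<in> H"
    and scale_mem: "f \<in> H \<Longrightarrow> (\<lambda>x. c * f x) \<in> H"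
    and ip_sym: "\<lbrakk>f \<in> H; g \<in> H\<rbrakk> \<Longrightarrow> ip f g = ip g f"
    and ip_add: "\<lbrakk>f \<in> H; g \<in> H; h \<in> H\<rbrakk> \<Longrightarrow> ip (\<lambda>x. f x + g x) h = ip f h + ip g h"
    and ip_scale: "\<lbrakk>f \<in> H; g \<in> H\<rbrakk> \<Longrightarrow> ip (\<lambda>x. c * f x) g = c * ip f g"
    and ip_nonneg: "f \<in> H \<Longrightarrow> 0 \<le> ip f f"
    and ip_definite: "\<lbrakk>f \<in> H; ip f f = 0\<rbrakk> \<Longrightarrow> f = (\<lambda>x. 0)"
    and complete: "\<lbrakk>\<And>i::nat. F i \<in> H;
         \<And>e. e > 0 \<Longrightarrow> \<exists>m. \<forall>i\<ge>m. \<forall>j\<ge>m. ip_norm ip (\<lambda>x. F i x - F j x) < e\<rbrakk>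
       \<Longrightarrow> \<exists>f\<in>H. (\<lambda>i. ip_norm ip (\<lambda>x. F i x - f x)) \<longlonglongrightarrow> 0"
    and section_mem: "x \<in> Z \<Longrightarrow> kernel_section Z K x \<in> H"
    and reproducing: "\<lbrakk>f \<in> H; x \<in> Z\<rbrakk> \<Longrightarrow> ip f (kernel_section Z K x) = f x"

definition control_rule :: "('n \<Rightarrow> 'a \<Rightarrow> real) \<Rightarrow> real^'n \<Rightarrow> 'n \<Rightarrow> 'a \<Rightarrow> real" where
  "control_rule f b n x = f n x + b $ n"

definition func_feasible ::
    "('n \<Rightarrow> ('a \<Rightarrow> real) set) \<Rightarrow> ('n \<Rightarrow> 't \<Rightarrow> 'a) \<Rightarrow> ('n \<Rightarrow> real^'t)
     \<Rightarrow> (('n \<Rightarrow> 'a \<Rightarrow> real) \<times> (real^'n)) set" where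
  "func_feasible H z qbar =
     {(f, b). (\<forall>n. f n \<in> H n) \<and> (\<forall>n t. \<bar>control_rule f b n (z n t)\<bar> \<le> qbar n $ t)}"

definition func_objective ::
    "real^'n^'n \<Rightarrow> ('t::finite \<Rightarrow> real^'n) \<Rightarrow> real
     \<Rightarrow> ('n \<Rightarrow> ('a \<Rightarrow> real) \<Rightarrow> ('a \<Rightarrow> real) \<Rightarrow> real) \<Rightarrow> ('n \<Rightarrow> 't \<Rightarrow> 'a)
     \<Rightarrow> ('n \<Rightarrow> 'a \<Rightarrow> real) \<times> (real^'n) \<Rightarrow> real" where
  "func_objective C y \<mu> ip z = (\<lambda>(f, b).
     1 / real CARD('t) * (\<Sum>t\<in>UNIV. (norm (C *v (\<chi> n. control_rule f b n (z n t)) + y t))\<^sup>2)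
     + \<mu> * (\<Sum>n\<in>UNIV. (ip_norm (ip n) (f n))\<^sup>2))"

definition kernel_matrix :: "('a \<Rightarrow> 'a \<Rightarrow> real) \<Rightarrow> ('t \<Rightarrow> 'a) \<Rightarrow> real^'t^'t" where
  "kernel_matrix K z = (\<chi> t t'. K (z t) (z t'))"

(* 1 :: real^'t is the all-ones vector and \<le> on vectors is entrywise. *)
definition vec_feasible ::
    "('n \<Rightarrow> real^'t^'t) \<Rightarrow> ('n \<Rightarrow> real^'t)
     \<Rightarrow> ((real^'t^'n) \<times> ('n \<Rightarrow> real^'t) \<times> (real^'n)) set" where
  "vec_feasible Kmat qbar =
     {(Q, a, b).
        (\<forall>n. column n (transpose Q) = Kmat n *v a n + b $ n *\<^sub>R 1) \<and>
        (\<forall>n. - qbar n \<le> Kmat n *v a n + b $ n *\<^sub>R 1 \<and> Kmat n *v a n + b $ n *\<^sub>R 1 \<le> qbar n)}"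

definition vec_objective ::
    "real^'n^'n \<Rightarrow> real^'t^'n \<Rightarrow> real \<Rightarrow> ('n \<Rightarrow> real^'t^'t)
     \<Rightarrow> (real^'t^'n) \<times> ('n \<Rightarrow> real^'t) \<times> (real^'n) \<Rightarrow> real" where
  "vec_objective C Y \<mu> Kmat = (\<lambda>(Q, a, b).
     1 / real CARD('t) * (frob_norm (C ** Q + Y))\<^sup>2 + \<mu> * (\<Sum>n\<in>UNIV. a n \<bullet> (Kmat n *v a n)))"

definition optimal_value :: "('x \<Rightarrow> real) \<Rightarrow> 'x set \<Rightarrow> ereal" where
  "optimal_value obj S = (INF x\<in>S. ereal (obj x))"

abbreviation minimizer :: "('x \<Rightarrow> real) \<Rightarrow> 'x set \<Rightarrow> 'x \<Rightarrow> bool" where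
  "minimizer obj S x \<equiv> is_arg_min obj (\<lambda>x. x \<in> S) x"

end

theory Submission imports Defs begin

text \<open>
  Writing g for the kernel expansion that takes the same values as f at the sample points, f - g
  vanishes there, so by the reproducing property it is orthogonal to g, and Pythagoras makes g
  strictly cheaper than f unless f = g. Such a g exists even when the kernel matrix is
  singular: a null vector of the kernel matrix yields an expansion of norm zero, so it is orthogonal
  to the vector of values of f, and the range of a symmetric matrix is the orthogonal complement of
  its null space.
\<close>

section \<open>Linear algebra: the range of a symmetric matrix\<close>

lemma in_range_symmetric_matrix:
  fixes A :: "real^'t^'t" and v :: "real^'t"
  assumes sym: "transpose A = A"
    and orth: "\<And>w. A *v w = 0 \<Longrightarrow> w \<bullet> v = 0"
  shows "\<exists>a. A *v a = v"
proof -
  have sub: "subspace (range ((*v) A))"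
    by (intro linear_subspace_image) auto
  obtain r w where r: "r \<in> span (range ((*v) A))"
    and w: "\<And>u. u \<in> span (range ((*v) A)) \<Longrightarrow> orthogonal w u" and v: "v = r + w"
    using orthogonal_subspace_decomp_exists[of "range ((*v) A)" v] by metis
  have perp: "w \<bullet> (A *v u) = 0" for u
    using w[of "A *v u"] by (simp add: orthogonal_def span_base)
  \<comment> \<open>Symmetry moves \<open>A\<close> to the other factor, so the component
    \<open>w\<close> orthogonal to the range is a null vector and \<open>orth\<close> applies to
    it.\<close>
  have "(A *v w) \<bullet> u = 0" for u
    using perp[of u] by (metis dot_lmul_matrix sym transpose_matrix_vector)
  then have "A *v w = 0" by (metis inner_eq_zero_iff)
  then have "w \<bullet> v = 0" by (rule orth)
  moreover have "w \<bullet> r = 0" using w[OF r] by (simp add: orthogonal_def)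
  \<comment> \<open>With \<open>v = r + w\<close>, subtracting the two products leaves
    \<open>w \<bullet> w = 0\<close>.\<close>
  ultimately have "w = 0" by (simp add: v inner_add_right)
  then have "v \<in> range ((*v) A)" using r v span_eq_iff[THEN iffD2, OF sub] by simp
  then show ?thesis by auto
qed

section \<open>Finite kernel expansions in a reproducing kernel Hilbert space\<close>

lemma (in rkhs)
  assumes "finite A" and "\<And>t. t \<in> A \<Longrightarrow> F t \<in> H"
  shows sum_mem: "(\<lambda>x. \<Sum>t\<in>A. c t * F t x) \<in> H"
    and ip_sum: "h \<in> H \<Longrightarrow> ip (\<lambda>x. \<Sum>t\<in>A. c t * F t x) h = (\<Sum>t\<in>A. c t * ip (F t) h)"
proof -
  \<comment> \<open>Both claims share one induction, because \<open>ip_add\<close> in the insertion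
    step asks for the partial sum to lie in \<open>H\<close>.\<close>
  have "(\<lambda>x. \<Sum>t\<in>A. c t * F t x) \<in> H \<and>
      (\<forall>h\<in>H. ip (\<lambda>x. \<Sum>t\<in>A. c t * F t x) h = (\<Sum>t\<in>A. c t * ip (F t) h))"
    using assms
  proof (induction A rule: finite_induct)
    case empty
    have "ip (\<lambda>x. 0) h = 0" if "h \<in> H" for h
      using ip_scale[OF zero_mem that, of 0] by simp
    then show ?case using zero_mem by simp
  next
    case (insert s A)
    have s: "(\<lambda>x. c s * F s x) \<in> H" using insert.prems scale_mem by simp
    have "ip (\<lambda>x. c s * F s x) h = c s * ip (F s) h" if "h \<in> H" for h
      using ip_scale that insert.prems by simp
    then show ?case
      using insert s ip_add[OF s] add_mem[OF s] by simp
  qed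
  then show "(\<lambda>x. \<Sum>t\<in>A. c t * F t x) \<in> H"
    and "h \<in> H \<Longrightarrow> ip (\<lambda>x. \<Sum>t\<in>A. c t * F t x) h = (\<Sum>t\<in>A. c t * ip (F t) h)"
    by auto
qed

lemma kernel_expansion_conv_sections:
  "kernel_expansion Z K z a = (\<lambda>x. \<Sum>t\<in>UNIV. a $ t * kernel_section Z K (z t) x)"
  by (auto simp: kernel_expansion_def kernel_section_def mult.commute)

lemma kernel_expansion_at_samples:
  assumes "range z \<subseteq> Z"
  shows "kernel_expansion Z K z a (z t) = (kernel_matrix K z *v a) $ t"
  using assms
  by (auto simp: kernel_expansion_def kernel_matrix_def matrix_vector_mult_def image_subset_iff)

context rkhs
begin

lemma kernel_expansion_mem:
  fixes z :: "'t::finite \<Rightarrow> 'a"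
  assumes "range z \<subseteq> Z"
  shows "kernel_expansion Z K z a \<in> H"
  unfolding kernel_expansion_conv_sections by (rule sum_mem) (use assms in \<open>auto intro!: section_mem\<close>)

text \<open>The reproducing property is applied term by term: pairing with an expansion sees
  \<open>f\<close> only through its sample values.\<close>

lemma ip_kernel_expansion:
  fixes z :: "'t::finite \<Rightarrow> 'a"
  assumes "range z \<subseteq> Z" and "f \<in> H"
  shows "ip (kernel_expansion Z K z a) f = (\<Sum>t\<in>UNIV. a $ t * f (z t))"
proof -
  have "ip (kernel_section Z K (z t)) f = f (z t)" for t
    using ip_sym[OF section_mem] reproducing assms by (simp add: image_subset_iff)
  then show ?thesis
    unfolding kernel_expansion_conv_sections
    using assms by (subst ip_sum) (auto intro!: section_mem)
qed

lemma ip_kernel_expansion_self: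
  fixes z :: "'t::finite \<Rightarrow> 'a"
  assumes "range z \<subseteq> Z"
  shows "ip (kernel_expansion Z K z a) (kernel_expansion Z K z a) = a \<bullet> (kernel_matrix K z *v a)"
  using assms
  by (simp add: ip_kernel_expansion kernel_expansion_mem kernel_expansion_at_samples inner_vec_def)

text \<open>Both sides are the inner product of the sections at \<open>x\<close> and
  \<open>x'\<close>, evaluated by the reproducing property.\<close>

lemma kernel_sym:
  assumes "x \<in> Z" and "x' \<in> Z"
  shows "K x x' = K x' x"
  using assms ip_sym[OF section_mem section_mem, of x x'] reproducing[OF section_mem]
  by (simp add: kernel_section_def)

section \<open>Interpolation at the samples and the representer theorem\<close>

lemma kernel_expansion_interpolates:
  fixes z :: "'t::finite \<Rightarrow> 'a"
  assumes z: "range z \<subseteq> Z" and f: "f \<in> H"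
  shows "\<exists>a. \<forall>t. kernel_expansion Z K z a (z t) = f (z t)"
proof -
  have "transpose (kernel_matrix K z) = kernel_matrix K z"
    using kernel_sym z by (simp add: image_subset_iff transpose_def kernel_matrix_def vec_eq_iff)
  moreover have "w \<bullet> (\<chi> t. f (z t)) = 0" if w: "kernel_matrix K z *v w = 0" for w
  proof -
    let ?g = "kernel_expansion Z K z w"
    \<comment> \<open>The squared norm of \<open>?g\<close> is the quadratic form of the kernel
      matrix at \<open>w\<close>, which vanishes.\<close>
    have "?g = (\<lambda>x. 0)"
      using ip_definite[OF kernel_expansion_mem[OF z]] ip_kernel_expansion_self[OF z] w by simp
    moreover have "w \<bullet> (\<chi> t. f (z t)) = ip ?g f"
      using ip_kernel_expansion[OF z f] by (simp add: inner_vec_def)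
    \<comment> \<open>Scaling the zero function by 0 shows that its inner product with
      \<open>f\<close> is 0.\<close>
    ultimately show ?thesis
      using ip_scale[OF zero_mem f, of 0] by simp
  qed
  ultimately obtain a where "kernel_matrix K z *v a = (\<chi> t. f (z t))"
    using in_range_symmetric_matrix by blast
  then show ?thesis
    using kernel_expansion_at_samples[OF z] by (metis vec_lambda_beta)
qed

text \<open>Interpolation supplies the candidate and Pythagoras compares the norms. The equality
  clause is what later forces every minimizer of (F) to be an expansion.\<close>

lemma representer:
  fixes z :: "'t::finite \<Rightarrow> 'a"
  assumes z: "range z \<subseteq> Z" and f: "f \<in> H"
  shows "\<exists>a. (\<forall>t. kernel_expansion Z K z a (z t) = f (z t)) \<and>
     ip (kernel_expansion Z K z a) (kernel_expansion Z K z a) \<le> ip f f \<and>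
     (ip (kernel_expansion Z K z a) (kernel_expansion Z K z a) = ip f f \<longrightarrow>
       kernel_expansion Z K z a = f)"
proof -
  obtain a where a: "\<And>t. kernel_expansion Z K z a (z t) = f (z t)"
    using kernel_expansion_interpolates[OF z f] by auto
  define g where "g = kernel_expansion Z K z a"
  define h where "h = (\<lambda>x. f x + (- 1) * g x)"
  have g: "g \<in> H" using kernel_expansion_mem[OF z] by (simp add: g_def)
  have h: "h \<in> H" unfolding h_def by (intro add_mem f scale_mem g)
  have f_eq: "f = (\<lambda>x. h x + g x)" by (simp add: h_def)
  \<comment> \<open>The function \<open>h\<close> vanishes at every sample, and these values are all
    that \<open>g\<close> pairs with.\<close>
  have "ip g h = 0" using ip_kernel_expansion[OF z h] a by (simp add: g_def h_def)
  moreover have "ip h f = ip h h + ip g h"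
    using ip_add[OF h g h] ip_sym[OF h f] f_eq by simp
  moreover have "ip g f = ip h g + ip g g"
    using ip_add[OF h g g] ip_sym[OF g f] f_eq by simp
  moreover have "ip f f = ip h f + ip g f"
    using ip_add[OF h g f] f_eq by simp
  ultimately have pyth: "ip f f = ip h h + ip g g"
    using ip_sym[OF h g] by simp
  have "g = f" if "ip g g = ip f f"
    using ip_definite[OF h] that pyth f_eq by simp
  then show ?thesis
    using a pyth ip_nonneg[OF h] by (intro exI[of _ a]) (auto simp: g_def)
qed

end

section \<open>Transfer between two minimization problems\<close>

text \<open>A point of \<open>S\<close> outside the image of \<open>E\<close> is strictly beaten by
  an image point, so it affects neither the infimum nor the set of minimizers. \<open>E\<close> may
  identify points, as happens for singular kernel matrices.\<close>

lemma problem_reduction: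
  fixes E :: "'x \<Rightarrow> 'y"
  assumes feas: "\<forall>x\<in>S'. E x \<in> S"
    and obj: "\<forall>x\<in>S'. F (E x) = F' x"
    and improve: "\<forall>s\<in>S. \<exists>x\<in>S'. E x = s \<or> F (E x) < F s"
  shows "optimal_value F S = optimal_value F' S'"
    and "minimizer F' S' x \<Longrightarrow> minimizer F S (E x)"
    and "minimizer F S s \<Longrightarrow> \<exists>x. minimizer F' S' x \<and> E x = s"
proof -
  have le: "\<exists>x\<in>S'. F' x \<le> F s" if "s \<in> S" for s
    using bspec[OF improve that] obj by force
  show "optimal_value F S = optimal_value F' S'"
    unfolding optimal_value_def
  proof (rule antisym)
    show "(INF s\<in>S. ereal (F s)) \<le> (INF x\<in>S'. ereal (F' x))"
      by (rule INF_mono) (use feas obj in force)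
    show "(INF x\<in>S'. ereal (F' x)) \<le> (INF s\<in>S. ereal (F s))"
      by (rule INF_mono) (use le in force)
  qed
  show "minimizer F S (E x)" if "minimizer F' S' x"
    \<comment> \<open>A point of \<open>S\<close> better than \<open>E x\<close> would, through
      \<open>le\<close>, yield a point of \<open>S'\<close> better than \<open>x\<close>.\<close>
    using that feas obj le unfolding is_arg_min_def by (metis order_less_le_trans not_le)
  show "\<exists>x. minimizer F' S' x \<and> E x = s" if "minimizer F S s"
  proof -
    \<comment> \<open>Minimality of \<open>s\<close> excludes the strict alternative in
      \<open>improve\<close>.\<close>
    from that obtain x where "x \<in> S'" "E x = s"
      using improve feas unfolding is_arg_min_def by metis
    with that show ?thesis
      using feas obj unfolding is_arg_min_def by metis
  qed
qed

section \<open>Comparison of (F) and (P) along kernel expansions\<close>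

text \<open>Columns are indexed by scenarios, so this brings the data term of (P) into the form of
  the one in (F).\<close>

lemma frob_norm_columns:
  fixes A :: "real^'t^'n"
  shows "(frob_norm A)\<^sup>2 = (\<Sum>t\<in>UNIV. (norm (column t A))\<^sup>2)"
proof -
  have "(frob_norm A)\<^sup>2 = (\<Sum>i\<in>UNIV. \<Sum>t\<in>UNIV. (A $ i $ t)\<^sup>2)"
    by (simp add: frob_norm_def sum_nonneg)
  also have "\<dots> = (\<Sum>t\<in>UNIV. \<Sum>i\<in>UNIV. (A $ i $ t)\<^sup>2)"
    by (rule sum.swap)
  finally show ?thesis
    unfolding power2_norm_eq_inner by (simp add: inner_vec_def column_def power2_eq_square)
qed

lemma column_affine:
  fixes C :: "real^'n^'n" and y :: "'t::finite \<Rightarrow> real^'n"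
  shows "column t (C ** Q + mat_of_columns y) = C *v column t Q + y t"
  by (simp add: vec_eq_iff column_def mat_of_columns_def matrix_matrix_mult_def
      matrix_vector_mult_def)

lemma abs_le_iff_interval: "\<bar>u\<bar> \<le> v \<longleftrightarrow> - v \<le> u \<and> u \<le> v" for u v :: real
  by auto

lemma kernel_expansion_feasible:
  fixes z :: "'n::finite \<Rightarrow> 't::finite \<Rightarrow> 'a"
  assumes rk: "\<And>n. rkhs (Z n) (K n) (H n) (ip n)"
    and z: "\<And>n. range (z n) \<subseteq> Z n"
    and feas: "(Q, a, b) \<in> vec_feasible (\<lambda>n. kernel_matrix (K n) (z n)) qbar"
  shows "(\<lambda>n. kernel_expansion (Z n) (K n) (z n) (a n), b) \<in> func_feasible H z qbar"
proof -
  have "- qbar n $ t \<le> (kernel_matrix (K n) (z n) *v a n) $ t + b $ n \<and>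
      (kernel_matrix (K n) (z n) *v a n) $ t + b $ n \<le> qbar n $ t" for n t
    using feas by (simp add: vec_feasible_def less_eq_vec_def)
  then show ?thesis
    using rkhs.kernel_expansion_mem[OF rk z] kernel_expansion_at_samples[OF z]
    by (simp add: func_feasible_def control_rule_def abs_le_iff_interval)
qed

lemma kernel_expansion_objective:
  fixes z :: "'n::finite \<Rightarrow> 't::finite \<Rightarrow> 'a" and C :: "real^'n^'n"
  assumes rk: "\<And>n. rkhs (Z n) (K n) (H n) (ip n)"
    and z: "\<And>n. range (z n) \<subseteq> Z n"
    and feas: "(Q, a, b) \<in> vec_feasible (\<lambda>n. kernel_matrix (K n) (z n)) qbar"
  shows "func_objective C y \<mu> ip z (\<lambda>n. kernel_expansion (Z n) (K n) (z n) (a n), b) =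
    vec_objective C (mat_of_columns y) \<mu> (\<lambda>n. kernel_matrix (K n) (z n)) (Q, a, b)"
proof -
  have Q: "column n (transpose Q) = kernel_matrix (K n) (z n) *v a n + b $ n *\<^sub>R 1" for n
    using feas by (simp add: vec_feasible_def)
  have "Q $ n $ t = (kernel_matrix (K n) (z n) *v a n) $ t + b $ n" for n t
    using arg_cong[OF Q, of "\<lambda>v. v $ t" n] by (simp add: column_def transpose_def)
  then have col: "(\<chi> n. control_rule (\<lambda>n. kernel_expansion (Z n) (K n) (z n) (a n)) b n (z n t)) =
      column t Q" for t
    using kernel_expansion_at_samples[OF z]
    by (simp add: vec_eq_iff column_def control_rule_def)
  \<comment> \<open>Squaring undoes the root in \<open>ip_norm\<close> because
    \<open>ip_nonneg\<close> makes the radicand nonnegative.\<close>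
  have "(ip_norm (ip n) (kernel_expansion (Z n) (K n) (z n) (a n)))\<^sup>2 =
      a n \<bullet> (kernel_matrix (K n) (z n) *v a n)" for n
    using rkhs.ip_kernel_expansion_self[OF rk z]
      rkhs.ip_nonneg[OF rk rkhs.kernel_expansion_mem[OF rk z]]
    by (simp add: ip_norm_def)
  then show ?thesis
    by (simp add: func_objective_def vec_objective_def col frob_norm_columns column_affine)
qed

text \<open>Replacing each \<open>f n\<close> by its interpolating expansion, with \<open>b\<close>
  kept, preserves all sample values, hence feasibility and the data term. Only the regularizer
  changes, and \<mu> > 0 turns its strict decrease into one of the objective.\<close>

lemma kernel_expansion_improves:
  fixes z :: "'n::finite \<Rightarrow> 't::finite \<Rightarrow> 'a" and C :: "real^'n^'n"
  assumes mu: "\<mu> > 0"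
    and rk: "\<And>n. rkhs (Z n) (K n) (H n) (ip n)"
    and z: "\<And>n. range (z n) \<subseteq> Z n"
    and feas: "(f, b) \<in> func_feasible H z qbar"
  shows "\<exists>Q a. (Q, a, b) \<in> vec_feasible (\<lambda>n. kernel_matrix (K n) (z n)) qbar \<and>
    ((\<lambda>n. kernel_expansion (Z n) (K n) (z n) (a n)) = f \<or>
     func_objective C y \<mu> ip z (\<lambda>n. kernel_expansion (Z n) (K n) (z n) (a n), b)
       < func_objective C y \<mu> ip z (f, b))"
proof -
  have f: "f n \<in> H n" for n using feas by (simp add: func_feasible_def)
  obtain a where a: "\<And>n t. kernel_expansion (Z n) (K n) (z n) (a n) (z n t) = f n (z n t)"
    and le: "\<And>n. ip n (kernel_expansion (Z n) (K n) (z n) (a n))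
        (kernel_expansion (Z n) (K n) (z n) (a n)) \<le> ip n (f n) (f n)"
    and eq: "\<And>n. ip n (kernel_expansion (Z n) (K n) (z n) (a n))
        (kernel_expansion (Z n) (K n) (z n) (a n)) = ip n (f n) (f n) \<Longrightarrow>
        kernel_expansion (Z n) (K n) (z n) (a n) = f n"
    using rkhs.representer[OF rk z f] by metis
  define g where "g = (\<lambda>n. kernel_expansion (Z n) (K n) (z n) (a n))"
  \<comment> \<open>The equality constraint forces this choice: row \<open>n\<close> of
    \<open>Q\<close> is column \<open>n\<close> of its transpose.\<close>
  define Q :: "real^'t^'n" where
    "Q = (\<chi> n. kernel_matrix (K n) (z n) *v a n + b $ n *\<^sub>R 1)"
  have Ka: "(kernel_matrix (K n) (z n) *v a n) $ t = f n (z n t)" for n t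
    using a kernel_expansion_at_samples[OF z] by metis
  have "(Q, a, b) \<in> vec_feasible (\<lambda>n. kernel_matrix (K n) (z n)) qbar"
    using feas
    by (auto simp: vec_feasible_def func_feasible_def control_rule_def Q_def less_eq_vec_def
        abs_le_iff_interval Ka column_def transpose_def vec_eq_iff)
  moreover have "g = f \<or> func_objective C y \<mu> ip z (g, b) < func_objective C y \<mu> ip z (f, b)"
  proof (cases "g = f")
    case False
    then obtain m where "g m \<noteq> f m" by auto
    then have lt: "ip m (g m) (g m) < ip m (f m) (f m)"
      using le[of m] eq[of m] by (force simp: g_def)
    have sq: "(ip_norm (ip n) h)\<^sup>2 = ip n h h" if "h \<in> H n" for n h
      using rkhs.ip_nonneg[OF rk that] by (simp add: ip_norm_def)
    have gH: "g n \<in> H n" for n using rkhs.kernel_expansion_mem[OF rk z] by (simp add: g_def)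
    \<comment> \<open>No summand grows and the one at \<open>m\<close> drops strictly.\<close>
    have "(\<Sum>n\<in>UNIV. ip n (g n) (g n)) < (\<Sum>n\<in>UNIV. ip n (f n) (f n))"
      using le lt by (intro sum_strict_mono_ex1) (auto simp: g_def)
    moreover have "control_rule g b n (z n t) = control_rule f b n (z n t)" for n t
      by (simp add: control_rule_def g_def a)
    ultimately show ?thesis
      using mu by (simp add: func_objective_def sq f gH)
  qed simp
  ultimately show ?thesis unfolding g_def by blast
qed

theorem lemma2:
  fixes R X C :: "real^'n^'n"
    and lam \<mu> :: real
    and pg pc qc y :: "'t::finite \<Rightarrow> real^'n"
    and Y :: "real^'t^'n"
    and M :: "'n \<Rightarrow> nat"
    and Z :: "'n \<Rightarrow> (nat \<Rightarrow> real) set"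
    and K :: "'n \<Rightarrow> (nat \<Rightarrow> real) \<Rightarrow> (nat \<Rightarrow> real) \<Rightarrow> real"
    and H :: "'n \<Rightarrow> ((nat \<Rightarrow> real) \<Rightarrow> real) set"
    and ip :: "'n \<Rightarrow> ((nat \<Rightarrow> real) \<Rightarrow> real) \<Rightarrow> ((nat \<Rightarrow> real) \<Rightarrow> real) \<Rightarrow> real"
    and z :: "'n \<Rightarrow> 't \<Rightarrow> nat \<Rightarrow> real"
    and qbar :: "'n \<Rightarrow> real^'t"
    and Kmat :: "'n \<Rightarrow> real^'t^'t"
  assumes "spd R" and "spd X"
    and "0 \<le> lam" and "lam \<le> 1"
    and "\<mu> > 0"
    and C: "C = spd_sqrt ((1 - lam) *\<^sub>R R + lam *\<^sub>R (X ** X))"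
    and y: "\<And>t. y t = matrix_inv C *v
               (- ((1 - lam) *\<^sub>R (R *v qc t)) + lam *\<^sub>R ((X ** R) *v (pg t - pc t))
                - lam *\<^sub>R ((X ** X) *v qc t))"
    and Y: "Y = mat_of_columns y"
    and "\<And>n. Z n \<subseteq> topspace (Euclidean_space (M n))"
    and "\<And>n. pd_kernel (Z n) (K n)"
    and "\<And>n. rkhs (Z n) (K n) (H n) (ip n)"
    and "\<And>n t. z n t \<in> Z n"
    and "\<And>n t. 0 \<le> qbar n $ t"
    and Kmat: "\<And>n. Kmat n = kernel_matrix (K n) (z n)"
  shows "optimal_value (func_objective C y \<mu> ip z) (func_feasible H z qbar)
           = optimal_value (vec_objective C Y \<mu> Kmat) (vec_feasible Kmat qbar)
       \<and> (\<forall>Q a b. minimizer (vec_objective C Y \<mu> Kmat) (vec_feasible Kmat qbar) (Q, a, b) \<longrightarrow>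
            minimizer (func_objective C y \<mu> ip z) (func_feasible H z qbar)
              (\<lambda>n. kernel_expansion (Z n) (K n) (z n) (a n), b))
       \<and> (\<forall>f b. minimizer (func_objective C y \<mu> ip z) (func_feasible H z qbar) (f, b) \<longrightarrow>
            (\<exists>Q a. minimizer (vec_objective C Y \<mu> Kmat) (vec_feasible Kmat qbar) (Q, a, b) \<and>
               f = (\<lambda>n. kernel_expansion (Z n) (K n) (z n) (a n))))"
proof -
  \<comment> \<open>Forgetting \<open>Q\<close> loses nothing on the feasible set, where
    \<open>a\<close> and \<open>b\<close> determine it.\<close>
  let ?E = "\<lambda>(Q :: real^'t^'n, a, b). (\<lambda>n. kernel_expansion (Z n) (K n) (z n) (a n), b :: real^'n)"
  have Kmat_eq: "Kmat = (\<lambda>n. kernel_matrix (K n) (z n))"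
    using Kmat by auto
  have z: "range (z n) \<subseteq> Z n" for n
    using assms(12) by auto
  have feas: "\<forall>x\<in>vec_feasible Kmat qbar. ?E x \<in> func_feasible H z qbar"
    using kernel_expansion_feasible[OF assms(11) z] unfolding Kmat_eq by auto
  have obj: "\<forall>x\<in>vec_feasible Kmat qbar.
      func_objective C y \<mu> ip z (?E x) = vec_objective C Y \<mu> Kmat x"
    using kernel_expansion_objective[OF assms(11) z] unfolding Kmat_eq Y by auto
  have improve: "\<forall>s\<in>func_feasible H z qbar. \<exists>x\<in>vec_feasible Kmat qbar.
      ?E x = s \<or> func_objective C y \<mu> ip z (?E x) < func_objective C y \<mu> ip z s"
  proof
    fix s assume feasible: "s \<in> func_feasible H z qbar"
    obtain f b where s: "s = (f, b)" by (cases s)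
    show "\<exists>x\<in>vec_feasible Kmat qbar.
        ?E x = s \<or> func_objective C y \<mu> ip z (?E x) < func_objective C y \<mu> ip z s"
      using kernel_expansion_improves[OF \<open>\<mu> > 0\<close> assms(11) z feasible[unfolded s], of C y]
      unfolding Kmat_eq s by (simp only: Bex_def split_paired_Ex case_prod_conv) blast
  qed
  note reduction = problem_reduction[OF feas obj improve]
  show ?thesis
  proof (intro conjI allI impI)
    show "optimal_value (func_objective C y \<mu> ip z) (func_feasible H z qbar)
        = optimal_value (vec_objective C Y \<mu> Kmat) (vec_feasible Kmat qbar)"
      by (rule reduction(1))
  next
    fix Q a b
    assume "minimizer (vec_objective C Y \<mu> Kmat) (vec_feasible Kmat qbar) (Q, a, b)"
    from reduction(2)[OF this]
    show "minimizer (func_objective C y \<mu> ip z) (func_feasible H z qbar)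
        (\<lambda>n. kernel_expansion (Z n) (K n) (z n) (a n), b)" by simp
  next
    fix f b
    assume "minimizer (func_objective C y \<mu> ip z) (func_feasible H z qbar) (f, b)"
    from reduction(3)[OF this]
    show "\<exists>Q a. minimizer (vec_objective C Y \<mu> Kmat) (vec_feasible Kmat qbar) (Q, a, b) \<and>
        f = (\<lambda>n. kernel_expansion (Z n) (K n) (z n) (a n))" by auto
  qed
qed

end
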